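(* Let $\mathbb{H}$ be a real Hilbert space and let $A\ne0$ be a positive bounded linear operator on $\mathbb{H}$ such that $\dim\overline{R(A)}<\infty$. Let $\epsilon\in[0,1)$ and $T\in B_{A^{1/2}}(\mathbb{H})$. Then $T$ is $(\epsilon,A)$-approximate right symmetric in the sense of Chmieliński if and only if $T$ is an $A$-isometry.
   Context: A bounded linear operator $A$ on $\mathbb{H}$ is positive if $A=A^*$ and $\langle Ax,x\rangle\ge0$ for all $x$; $R(A)$ is its range. Put $\langle x,y\rangle_A=\langle Ax,y\rangle$, $\|x\|_A=\sqrt{\langle Ax,x\rangle}$, and $S_{\mathbb{H}(A)}=\{x\in\mathbb{H}:\|x\|_A=1\}$. $B_{A^{1/2}}(\mathbb{H})$ is the set of $A$-bounded operators, i.e. bounded linear operators $T$ on $\mathbb{H}$ for which there is $c>0$ with $\|Tx\|_A\le c\|x\|_A$ for all $x\in\mathbb{H}$; for such $T$, $\|T\|_A=\sup\{\|Tx\|_A:\|x\|_A=1\}$, and $M_A^T=\{x\in\mathbb{H}:\|x\|_A=1,\ \|Tx\|_A=\|T\|_A\}$. $T\in B_{A^{1/2}}(\mathbb{H})$ is called an $A$-isometry if $M_A^T=S_{\mathbb{H}(A)}$ (so $\|T\|_A$ need not be $1$). For $T,S\in B_{A^{1/2}}(\mathbb{H})$, $T\bot_{\epsilon(A)}S$ means $\|T+\lambda S\|_A^2\ge\|T\|_A^2-2\epsilon\|T\|_A\|\lambda S\|_A$ for all scalars $\lambda$. $T\in B_{A^{1/2}}(\mathbb{H})$ is $(\epsilon,A)$-approximate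 right symmetric in the sense of Chmieliński if for every $S\in B_{A^{1/2}}(\mathbb{H})$, $S\bot_{\epsilon(A)}T$ implies $T\bot_{\epsilon(A)}S$. *)

theory Defs
  imports "HOL-Analysis.Analysis"
begin

(* Bounded linear operators on the Hilbert space are elements of the type 'a \<Rightarrow>\<^sub>L 'a. *)

(* The first conjunct is A = A*; see adjoint_eq_if_positive_op below. *)
definition positive_op :: "('a::real_inner \<Rightarrow>\<^sub>L 'a) \<Rightarrow> bool" where
  "positive_op A \<longleftrightarrow> (\<forall>x y. A x \<bullet> y = x \<bullet> A y) \<and> (\<forall>x. 0 \<le> A x \<bullet> x)"

lemma adjoint_eq_if_positive_op:
  assumes "positive_op A"
  shows "adjoint (blinfun_apply A) = blinfun_apply A"
  using assms unfolding positive_op_def by (intro adjoint_unique) auto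

(* The library function dim is 0 on infinite-dimensional sets, so "dim V < infinity" has to be
   stated as the existence of a finite spanning set. *)
definition finite_dim :: "'a::real_vector set \<Rightarrow> bool" where
  "finite_dim V \<longleftrightarrow> (\<exists>B. finite B \<and> span B = V)"

definition A_inner :: "('a::real_inner \<Rightarrow>\<^sub>L 'a) \<Rightarrow> 'a \<Rightarrow> 'a \<Rightarrow> real" where
  "A_inner A x y = A x \<bullet> y"

definition A_norm :: "('a::real_inner \<Rightarrow>\<^sub>L 'a) \<Rightarrow> 'a \<Rightarrow> real" where
  "A_norm A x = sqrt (A_inner A x x)"

definition A_sphere :: "('a::real_inner \<Rightarrow>\<^sub>L 'a) \<Rightarrow> 'a set" where
  "A_sphere A = {x. A_norm A x = 1}"

definition A_bounded_ops :: "('a::real_inner \<Rightarrow>\<^sub>L 'a) \<Rightarrow> ('a \<Rightarrow>\<^sub>L 'a) set" where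
  "A_bounded_ops A = {T. \<exists>c>0. \<forall>x. A_norm A (blinfun_apply T x) \<le> c * A_norm A x}"

(* For positive A \<noteq> 0 and A-bounded T this is the supremum of a nonempty set of reals
   that is bounded above. *)
definition A_opnorm :: "('a::real_inner \<Rightarrow>\<^sub>L 'a) \<Rightarrow> ('a \<Rightarrow>\<^sub>L 'a) \<Rightarrow> real" where
  "A_opnorm A T = (SUP x\<in>A_sphere A. A_norm A (T x))"

definition A_norm_attain :: "('a::real_inner \<Rightarrow>\<^sub>L 'a) \<Rightarrow> ('a \<Rightarrow>\<^sub>L 'a) \<Rightarrow> 'a set" where
  "A_norm_attain A T = {x. A_norm A x = 1 \<and> A_norm A (T x) = A_opnorm A T}"

(* An A-isometry need not have A-operator norm 1; the zero operator is one. *)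
definition A_isometry :: "('a::real_inner \<Rightarrow>\<^sub>L 'a) \<Rightarrow> ('a \<Rightarrow>\<^sub>L 'a) \<Rightarrow> bool" where
  "A_isometry A T \<longleftrightarrow> T \<in> A_bounded_ops A \<and> A_norm_attain A T = A_sphere A"

definition approx_orth ::
    "real \<Rightarrow> ('a::real_inner \<Rightarrow>\<^sub>L 'a) \<Rightarrow> ('a \<Rightarrow>\<^sub>L 'a) \<Rightarrow> ('a \<Rightarrow>\<^sub>L 'a) \<Rightarrow> bool" where
  "approx_orth \<epsilon> A T S \<longleftrightarrow>
     (\<forall>l::real. (A_opnorm A (T + l *\<^sub>R S))\<^sup>2
        \<ge> (A_opnorm A T)\<^sup>2 - 2 * \<epsilon> * A_opnorm A T * A_opnorm A (l *\<^sub>R S))"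

(* Approximate right symmetry in the sense of Chmielinski. *)
definition approx_right_symmetric ::
    "real \<Rightarrow> ('a::real_inner \<Rightarrow>\<^sub>L 'a) \<Rightarrow> ('a \<Rightarrow>\<^sub>L 'a) \<Rightarrow> bool" where
  "approx_right_symmetric \<epsilon> A T \<longleftrightarrow> T \<in> A_bounded_ops A \<and>
     (\<forall>S\<in>A_bounded_ops A. approx_orth \<epsilon> A S T \<longrightarrow> approx_orth \<epsilon> A T S)"

end

theory Submission
  imports Defs
begin

text \<open>
  If \<open>T\<close> is an \<open>A\<close>-isometry, expanding \<open>\<parallel>T x + l S x\<parallel>\<^sub>A\<^sup>2\<close> and \<open>\<parallel>S x + \<mu> l T x\<parallel>\<^sub>A\<^sup>2\<close> shows that a failure
  of \<open>T \<bottom> S\<close> at \<open>l\<close> bounds \<open>l \<langle>S x, T x\<rangle>\<^sub>A\<close> away from the critical value on the whole sphere, so that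
  \<open>S \<bottom> T\<close> fails at \<open>\<mu> l\<close> for small \<open>\<mu>\<close>.

  Otherwise put \<open>t = \<parallel>T\<parallel>\<^sub>A\<close> and let \<open>y\<close> minimise \<open>\<parallel>T y\<parallel>\<^sub>A\<close> on the \<open>A\<close>-sphere, with minimum \<open>m < t\<close>.
  Then \<open>T\<close> maps the \<open>A\<close>-orthogonal complement of \<open>y\<close> into that of \<open>T y\<close>. Choose an \<open>A\<close>-unit vector
  \<open>u\<close> orthogonal to the image of this complement with \<open>\<langle>T y, u\<rangle>\<^sub>A \<le> 0\<close> (for \<open>m = 0\<close> it exists by a
  dimension count), and let \<open>S\<close> agree with \<open>T\<close> on the complement and send \<open>y\<close> to \<open>t u\<close>. Then
  \<open>S \<bottom> T\<close> even for \<open>\<epsilon> = 0\<close>, whereas \<open>\<parallel>T - l S\<parallel>\<^sub>A \<le> (1 - l) t\<close> for small \<open>l > 0\<close>, which violates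
  \<open>T \<bottom> S\<close> because \<open>\<epsilon> < 1\<close>.
\<close>

text \<open>The degenerate case \<open>c = 0\<close> has to be covered because \<open>A\<close> may
  have a kernel. The lemma yields both Cauchy-Schwarz and the first-order condition at a
  minimiser.\<close>

lemma discriminant_le:
  fixes a b c :: real
  assumes "0 \<le> c" and nonneg: "\<And>s. 0 \<le> a + 2 * s * b + s\<^sup>2 * c"
  shows "b\<^sup>2 \<le> a * c"
proof (cases "c = 0")
  case True
  have "b = 0"
  proof (rule ccontr)
    assume "b \<noteq> 0"
    \<comment> \<open>At this value of \<open>s\<close> the remaining affine function equals
      -1.\<close>
    then show False
      using nonneg[of "- (a + 1) / (2 * b)"] True by (simp add: field_simps)
  qed
  then show ?thesis using True by simp
next
  case False
  then have "c > 0" using assms(1) by simp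
  \<comment> \<open>Here \<open>s\<close> is the vertex of the parabola.\<close>
  then show ?thesis
    using nonneg[of "- b / c"] by (simp add: field_simps power2_eq_square)
qed

lemma A_norm_scaleR: "A_norm A (r *\<^sub>R x) = \<bar>r\<bar> * A_norm A x"
  by (simp add: A_norm_def A_inner_def blinfun.scaleR_right real_sqrt_mult flip: mult.assoc)

lemma continuous_on_A_norm: "continuous_on X (A_norm A)"
  unfolding A_norm_def A_inner_def by (intro continuous_intros)

section \<open>The semi-inner product of a positive operator\<close>

context
  fixes A :: "'a::real_inner \<Rightarrow>\<^sub>L 'a"
  assumes pos: "positive_op A"
begin

lemma A_commute: "A x \<bullet> y = A y \<bullet> x"
  using pos by (metis positive_op_def inner_commute)

lemma A_nonneg: "0 \<le> A x \<bullet> x"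
  using pos unfolding positive_op_def by blast

lemma A_norm_sq: "(A_norm A x)\<^sup>2 = A x \<bullet> x"
  by (simp add: A_norm_def A_inner_def A_nonneg)

lemma A_norm_nonneg: "0 \<le> A_norm A x"
  by (simp add: A_norm_def A_inner_def A_nonneg)

lemma A_norm_eq_1_iff: "A_norm A x = 1 \<longleftrightarrow> A x \<bullet> x = 1"
  by (simp add: A_norm_def A_inner_def)

lemma A_square_add:
  "A (x + r *\<^sub>R y) \<bullet> (x + r *\<^sub>R y) = A x \<bullet> x + 2 * r * (A x \<bullet> y) + r\<^sup>2 * (A y \<bullet> y)"
  using A_commute[of y x]
  by (simp add: blinfun.bilinear_simps inner_simps algebra_simps power2_eq_square)

lemma A_Cauchy_Schwarz: "(A x \<bullet> y)\<^sup>2 \<le> (A x \<bullet> x) * (A y \<bullet> y)"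
  using A_nonneg[of "x + _ *\<^sub>R y"] unfolding A_square_add
  by (intro discriminant_le A_nonneg) auto

text \<open>Cauchy-Schwarz for \<open>x\<close> and \<open>A x\<close> bounds the square of
  \<open>A x \<bullet> A x\<close> by a multiple of \<open>A x \<bullet> x\<close>. Thus the null
  vectors of the seminorm are exactly the kernel of \<open>A\<close>.\<close>

lemma A_eq_0_iff: "A x = 0 \<longleftrightarrow> A x \<bullet> x = 0"
  using A_Cauchy_Schwarz[of x "A x"] by auto

lemma A_norm_triangle: "A_norm A (x + y) \<le> A_norm A x + A_norm A y"
proof (rule power2_le_imp_le)
  have "\<bar>A x \<bullet> y\<bar> \<le> A_norm A x * A_norm A y"
    by (rule power2_le_imp_le)
       (auto simp: power_mult_distrib A_norm_sq A_norm_nonneg A_Cauchy_Schwarz)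
  then show "(A_norm A (x + y))\<^sup>2 \<le> (A_norm A x + A_norm A y)\<^sup>2"
    using A_square_add[of x 1 y] by (simp add: power2_sum A_norm_sq)
qed (simp add: A_norm_nonneg)

lemma A_norm_pos:
  assumes "A x \<noteq> 0"
  shows "0 < A_norm A x"
proof -
  have "A x \<bullet> x \<noteq> 0" using assms A_eq_0_iff by blast
  then have "0 < A x \<bullet> x" using A_nonneg[of x] by linarith
  then show ?thesis by (simp add: A_norm_def A_inner_def)
qed

lemma A_normalize:
  assumes "A x \<noteq> 0"
  shows "A_norm A ((1 / A_norm A x) *\<^sub>R x) = 1"
  using A_norm_pos[OF assms] by (simp add: A_norm_scaleR)

text \<open>\<open>T\<close> descends to the quotient by the kernel of \<open>A\<close>, so
  identities modulo this kernel may be pushed through \<open>T\<close>.\<close>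

lemma A_bounded_apply_eq_0:
  assumes "T \<in> A_bounded_ops A" "A x = 0"
  shows "A (T x) = 0"
proof -
  obtain c where "A_norm A (T x) \<le> c * A_norm A x"
    using assms(1) by (auto simp: A_bounded_ops_def)
  moreover have "A_norm A x = 0" using assms(2) by (simp add: A_norm_def A_inner_def)
  ultimately have "A_norm A (T x) = 0" using A_norm_nonneg[of "T x"] by simp
  then have "A (T x) \<bullet> T x = 0" using A_norm_sq[of "T x"] by simp
  then show ?thesis using A_eq_0_iff by blast
qed

section \<open>Closure properties of the \<open>A\<close>-bounded operators\<close>

lemma A_bounded_ops_add:
  assumes "S \<in> A_bounded_ops A" "T \<in> A_bounded_ops A"
  shows "S + T \<in> A_bounded_ops A"
proof -
  obtain c d where c: "c > 0" "\<And>x. A_norm A (S x) \<le> c * A_norm A x"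
    and d: "d > 0" "\<And>x. A_norm A (T x) \<le> d * A_norm A x"
    using assms by (auto simp: A_bounded_ops_def)
  have "A_norm A ((S + T) x) \<le> (c + d) * A_norm A x" for x
    using A_norm_triangle[of "S x" "T x"] c(2)[of x] d(2)[of x]
    by (simp add: blinfun.add_left algebra_simps)
  then show ?thesis using c(1) d(1) unfolding A_bounded_ops_def
    by (auto intro!: exI[of _ "c + d"])
qed

lemma A_bounded_opsI:
  assumes "\<And>x. A_norm A (blinfun_apply T x) \<le> c * A_norm A x"
  shows "T \<in> A_bounded_ops A"
proof -
  have "A_norm A (T x) \<le> (\<bar>c\<bar> + 1) * A_norm A x" for x
  proof -
    have "c * A_norm A x \<le> (\<bar>c\<bar> + 1) * A_norm A x"
      by (intro mult_right_mono) (auto simp: A_norm_nonneg)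
    then show ?thesis using assms[of x] by linarith
  qed
  then show ?thesis unfolding A_bounded_ops_def by (auto intro!: exI[of _ "\<bar>c\<bar> + 1"])
qed

lemma A_bounded_ops_scaleR:
  assumes "T \<in> A_bounded_ops A"
  shows "r *\<^sub>R T \<in> A_bounded_ops A"
proof -
  obtain c where c: "\<And>x. A_norm A (T x) \<le> c * A_norm A x"
    using assms by (auto simp: A_bounded_ops_def)
  have "A_norm A ((r *\<^sub>R T) x) \<le> (\<bar>r\<bar> * c) * A_norm A x" for x
    using mult_left_mono[OF c[of x], of "\<bar>r\<bar>"]
    by (simp add: blinfun.scaleR_left A_norm_scaleR algebra_simps)
  then show ?thesis by (rule A_bounded_opsI)
qed

section \<open>Orthonormal systems, minimisers and dimension counts\<close>

lemma A_orthonormal_card_le: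
  assumes "finite B" "range (blinfun_apply A) \<subseteq> span B" "finite F"
    and on: "\<And>f g. f \<in> F \<Longrightarrow> g \<in> F \<Longrightarrow> A f \<bullet> g = (if f = g then 1 else 0)"
  shows "card F \<le> card B"
proof -
  have inj: "inj_on A F" by (rule inj_onI) (metis on zero_neq_one)
  \<comment> \<open>Pairing a vanishing combination of the vectors \<open>A f\<close> with a fixed
    \<open>g\<close> isolates the coefficient of \<open>A g\<close>.\<close>
  have "independent (A ` F)"
  proof
    assume "dependent (A ` F)"
    then obtain c v where v: "v \<in> A ` F" "c v \<noteq> 0" and sum0: "(\<Sum>w\<in>A ` F. c w *\<^sub>R w) = 0"
      using assms(3) by (auto simp: dependent_finite)
    then obtain g where g: "g \<in> F" "v = A g" by auto
    have "0 = (\<Sum>f\<in>F. c (A f) *\<^sub>R A f) \<bullet> g"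
      using sum0 inj by (simp add: sum.reindex)
    also have "\<dots> = (\<Sum>f\<in>F. if f = g then c (A f) else 0)"
      unfolding inner_sum_left using on g by (intro sum.cong) auto
    also have "\<dots> = c v" using g assms(3) by simp
    finally show False using v by simp
  qed
  then have "card (A ` F) \<le> card B"
    using independent_span_bound[OF assms(1), of "A ` F"] assms(2) by blast
  then show ?thesis using inj by (simp add: card_image)
qed

lemma A_residual_orthogonal:
  assumes "finite F" "g \<in> F"
    and on: "\<And>f g. f \<in> F \<Longrightarrow> g \<in> F \<Longrightarrow> A f \<bullet> g = (if f = g then 1 else 0)"
  shows "A (x - (\<Sum>f\<in>F. (A x \<bullet> f) *\<^sub>R f)) \<bullet> g = 0"
proof -
  have "A (\<Sum>f\<in>F. (A x \<bullet> f) *\<^sub>R f) \<bullet> g = (\<Sum>f\<in>F. if f = g then A x \<bullet> f else 0)"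
    unfolding blinfun.sum_right inner_sum_left using on assms(2)
    by (intro sum.cong) (auto simp: blinfun.scaleR_right)
  also have "\<dots> = A x \<bullet> g" using assms by simp
  finally show ?thesis by (simp add: blinfun.diff_right inner_diff_left)
qed

text \<open>An \<open>A\<close>-orthonormal system of maximal size in \<open>W\<close> works; sizes
  are bounded by \<open>card B\<close>. A residual outside the kernel of \<open>A\<close> could be
  normalised and added to the system. The expansion is an identity modulo that kernel.\<close>

lemma A_orthonormal_basis_exists:
  assumes "finite B" "range (blinfun_apply A) \<subseteq> span B" "subspace W"
  obtains F where "finite F" "F \<subseteq> W"
    "\<And>f g. f \<in> F \<Longrightarrow> g \<in> F \<Longrightarrow> A f \<bullet> g = (if f = g then 1 else 0)"
    "\<And>x. x \<in> W \<Longrightarrow> A (x - (\<Sum>f\<in>F. (A x \<bullet> f) *\<^sub>R f)) = 0"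
proof -
  define P where "P F \<longleftrightarrow> finite F \<and> F \<subseteq> W \<and>
    (\<forall>f\<in>F. \<forall>g\<in>F. A f \<bullet> g = (if f = g then 1 else 0))" for F
  have "P {}" by (simp add: P_def)
  moreover have "\<forall>F. P F \<longrightarrow> card F < Suc (card B)"
    using A_orthonormal_card_le[OF assms(1,2)] by (auto simp: P_def less_Suc_eq_le)
  ultimately obtain F where F: "P F" and max: "\<And>G. P G \<Longrightarrow> card G \<le> card F"
    using ex_has_greatest_nat[of P "{}" card "Suc (card B)"] by (metis less_imp_le)
  have fin: "finite F" and FW: "F \<subseteq> W"
    and on: "\<And>f g. f \<in> F \<Longrightarrow> g \<in> F \<Longrightarrow> A f \<bullet> g = (if f = g then 1 else 0)"
    using F by (auto simp: P_def)
  have "A (x - (\<Sum>f\<in>F. (A x \<bullet> f) *\<^sub>R f)) = 0" if "x \<in> W" for x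
  proof (rule ccontr)
    define r where "r = x - (\<Sum>f\<in>F. (A x \<bullet> f) *\<^sub>R f)"
    define u where "u = (1 / A_norm A r) *\<^sub>R r"
    assume "A (x - (\<Sum>f\<in>F. (A x \<bullet> f) *\<^sub>R f)) \<noteq> 0"
    then have u1: "A u \<bullet> u = 1"
      using A_normalize[of r] by (simp add: A_norm_eq_1_iff r_def[symmetric] u_def)
    have uF: "A u \<bullet> g = 0" if "g \<in> F" for g
      using A_residual_orthogonal[OF fin that on, of x]
      by (simp add: u_def r_def blinfun.scaleR_right)
    then have "u \<notin> F" using u1 by auto
    have "r \<in> W" unfolding r_def using that FW assms(3)
      by (intro subspace_diff subspace_sum subspace_scale) auto
    then have "u \<in> W" unfolding u_def using assms(3) by (intro subspace_scale)
    moreover have "A g \<bullet> u = 0" if "g \<in> F" for g using uF[OF that] by (simp only: A_commute[of g])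
    ultimately have "P (insert u F)"
      using fin FW on u1 uF \<open>u \<notin> F\<close> unfolding P_def by auto
    from max[OF this] show False using fin \<open>u \<notin> F\<close> by simp
  qed
  then show ?thesis using that fin FW on by blast
qed

text \<open>The \<open>A\<close>-sphere is unbounded when \<open>A\<close> has a nontrivial kernel,
  so compactness is taken from coordinates instead: modulo the kernel, each unit vector is a
  combination of a finite orthonormal system with coefficients in [-1,1].\<close>

lemma A_norm_attains_min:
  assumes "finite B" "range (blinfun_apply A) \<subseteq> span B" "A \<noteq> 0" "T \<in> A_bounded_ops A"
  obtains y where "A_norm A y = 1"
    "\<And>x. A_norm A x = 1 \<Longrightarrow> A_norm A (T y) \<le> A_norm A (T x)"
proof -
  obtain F where fin: "finite F"
    and on: "\<And>f g. f \<in> F \<Longrightarrow> g \<in> F \<Longrightarrow> A f \<bullet> g = (if f = g then 1 else 0)"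
    and null_UNIV: "\<And>x. x \<in> UNIV \<Longrightarrow> A (x - (\<Sum>f\<in>F. (A x \<bullet> f) *\<^sub>R f)) = 0"
    by (rule A_orthonormal_basis_exists[OF assms(1,2) subspace_UNIV]) blast
  note null = null_UNIV[OF UNIV_I]
  define L where "L c = (\<Sum>f\<in>F. c f *\<^sub>R f)" for c :: "'a \<Rightarrow> real"
  \<comment> \<open>Coordinates outside \<open>F\<close> are frozen at 0, so that \<open>C\<close>
    is a product of compact sets over the whole index type and Tychonoff's theorem applies.\<close>
  define C where "C = (\<Pi>\<^sub>E f\<in>UNIV. if f \<in> F then {-1..1::real} else {0})"
  have "compact C"
    using compactin_PiE[of "\<lambda>_. euclidean" UNIV "\<lambda>f. if f \<in> F then {-1..1::real} else {0}"]
    unfolding C_def euclidean_product_topology by (auto simp: compactin_euclidean_iff)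
  moreover have "continuous_on C L"
    unfolding L_def
    by (intro continuous_intros continuous_on_subset[OF continuous_on_product_coordinates]) auto
  ultimately have "compact (L ` C)" by (intro compact_continuous_image)
  moreover have "closed (A_sphere A)"
    unfolding A_sphere_def by (intro closed_Collect_eq continuous_on_A_norm continuous_on_const)
  ultimately have comp: "compact (L ` C \<inter> A_sphere A)" by (rule compact_Int_closed)
  \<comment> \<open>The expansion of \<open>x\<close> differs from \<open>x\<close> by an element of
    the kernel of \<open>A\<close>. Since \<open>T\<close> preserves this kernel, neither the
    seminorm of the vector nor that of its image changes.\<close>
  have repr: "L (\<lambda>f. if f \<in> F then A x \<bullet> f else 0) \<in> L ` C \<inter> A_sphere A"
      "A_norm A (T (L (\<lambda>f. if f \<in> F then A x \<bullet> f else 0))) = A_norm A (T x)"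
    if x: "A_norm A x = 1" for x
  proof -
    let ?z = "L (\<lambda>f. if f \<in> F then A x \<bullet> f else 0)"
    have z: "?z = (\<Sum>f\<in>F. (A x \<bullet> f) *\<^sub>R f)" unfolding L_def by (intro sum.cong) auto
    have "\<bar>A x \<bullet> f\<bar> \<le> 1" if "f \<in> F" for f
      using A_Cauchy_Schwarz[of x f] x on[OF that that] abs_square_le_1[of "A x \<bullet> f"]
      by (simp add: A_norm_eq_1_iff)
    then have "(\<lambda>f. if f \<in> F then A x \<bullet> f else 0) \<in> C" by (auto simp: C_def abs_le_iff minus_le_iff)
    then have "?z \<in> L ` C" by (rule imageI)
    have eq: "A_norm A v = A_norm A w" if "A (v - w) = 0" for v w
    proof -
      have "A v = A w" using that by (simp add: blinfun.diff_right)
      then have "A v \<bullet> v = A w \<bullet> w" by (metis A_commute)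
      then show ?thesis by (simp add: A_norm_def A_inner_def)
    qed
    have "A (x - ?z) = 0" using null[of x] by (simp only: z)
    then have "A (T x - T ?z) = 0"
      using A_bounded_apply_eq_0[OF assms(4)] by (simp only: blinfun.diff_right[of T, symmetric])
    from eq[OF this] show "A_norm A (T ?z) = A_norm A (T x)" by (rule sym)
    show "?z \<in> L ` C \<inter> A_sphere A"
      using eq[OF \<open>A (x - ?z) = 0\<close>] \<open>?z \<in> L ` C\<close> x unfolding A_sphere_def by simp
  qed
  obtain v where "A v \<noteq> 0" using assms(3) by (metis blinfun_eqI zero_blinfun.rep_eq)
  then have "L ` C \<inter> A_sphere A \<noteq> {}" using repr(1)[OF A_normalize] by blast
  moreover have "continuous_on (L ` C \<inter> A_sphere A) (\<lambda>x. A_norm A (T x))"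
    by (rule continuous_on_compose2[OF continuous_on_A_norm[of UNIV]]) (auto intro: continuous_intros)
  ultimately obtain y where y: "y \<in> L ` C \<inter> A_sphere A"
    and min: "\<And>x. x \<in> L ` C \<inter> A_sphere A \<Longrightarrow> A_norm A (T y) \<le> A_norm A (T x)"
    using continuous_attains_inf[OF comp] by blast
  show ?thesis
  proof (rule that)
    show "A_norm A y = 1" using y by (simp add: A_sphere_def)
    show "A_norm A (T y) \<le> A_norm A (T x)" if "A_norm A x = 1" for x
      using min[OF repr(1)[OF that]] unfolding repr(2)[OF that] .
  qed
qed

text \<open>The form \<open>A (T x) \<bullet> T x - m * (A x \<bullet> x)\<close>, with
  \<open>m\<close> the minimum, is nonnegative and vanishes at \<open>y\<close>. Hence its polar
  form vanishes against \<open>y\<close>, and the second term drops out for \<open>w\<close>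
  orthogonal to \<open>y\<close>.\<close>

lemma A_norm_min_orthogonal:
  fixes T :: "'a \<Rightarrow>\<^sub>L 'a"
  assumes y: "A y \<bullet> y = 1" and w: "A y \<bullet> w = 0"
    and min: "\<And>x. A x \<bullet> x = 1 \<Longrightarrow> A (T y) \<bullet> T y \<le> A (T x) \<bullet> T x"
  shows "A (T y) \<bullet> T w = 0"
proof -
  define m where "m = A (T y) \<bullet> T y"
  \<comment> \<open>Homogeneity extends minimality from the sphere to all vectors outside the kernel
    of \<open>A\<close>.\<close>
  have min': "m * (A x \<bullet> x) \<le> A (T x) \<bullet> T x" for x
  proof (cases "A x = 0")
    case True
    then show ?thesis by (simp add: A_nonneg)
  next
    case False
    have pos: "A_norm A x > 0"
      using False by (rule A_norm_pos)
    have "m \<le> A (T ((1 / A_norm A x) *\<^sub>R x)) \<bullet> T ((1 / A_norm A x) *\<^sub>R x)"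
      unfolding m_def using A_normalize[OF False] by (intro min) (simp only: A_norm_eq_1_iff)
    then have "m * (A_norm A x)\<^sup>2 \<le> A (T x) \<bullet> T x"
      using pos by (simp add: blinfun.scaleR_right field_simps power2_eq_square)
    then show ?thesis by (simp add: A_norm_sq)
  qed
  have "(A (T y) \<bullet> T w)\<^sup>2 \<le> 0 * (A (T w) \<bullet> T w - m * (A w \<bullet> w))"
  proof (rule discriminant_le)
    fix s
    have "m * (1 + s\<^sup>2 * (A w \<bullet> w)) \<le> m + 2 * s * (A (T y) \<bullet> T w) + s\<^sup>2 * (A (T w) \<bullet> T w)"
      using min'[of "y + s *\<^sub>R w"] A_square_add[of y s w] A_square_add[of "T y" s "T w"] y w
      by (simp add: blinfun.add_right blinfun.scaleR_right flip: m_def)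
    then show "0 \<le> 0 + 2 * s * (A (T y) \<bullet> T w) + s\<^sup>2 * (A (T w) \<bullet> T w - m * (A w \<bullet> w))"
      by (simp add: algebra_simps)
  qed (use min' in simp)
  then show ?thesis by simp
qed

text \<open>Serves the case of minimum 0. Modulo the kernel of \<open>A\<close>, the operator
  \<open>T\<close> kills the nonzero vector \<open>y\<close>, so its range has smaller dimension
  than the whole space.\<close>

lemma A_orthogonal_to_range_exists:
  assumes "finite B" "range (blinfun_apply A) \<subseteq> span B"
    and T: "T \<in> A_bounded_ops A" and y: "A y \<noteq> 0" "A (T y) = 0"
  obtains u where "A_norm A u = 1" "\<And>x. A (T x) \<bullet> u = 0"
proof -
  have "subspace (range T)"
    by (intro linear_subspace_image subspace_UNIV) (simp add: blinfun.bounded_linear_right bounded_linear.linear)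
  then obtain F where fin: "finite F" and FT: "F \<subseteq> range T"
    and on: "\<And>f g. f \<in> F \<Longrightarrow> g \<in> F \<Longrightarrow> A f \<bullet> g = (if f = g then 1 else 0)"
    and null_range: "\<And>x. x \<in> range T \<Longrightarrow> A (x - (\<Sum>f\<in>F. (A x \<bullet> f) *\<^sub>R f)) = 0"
    by (rule A_orthonormal_basis_exists[OF assms(1,2)]) blast
  have null: "A (T x - (\<Sum>f\<in>F. (A (T x) \<bullet> f) *\<^sub>R f)) = 0" for x
    by (rule null_range) (rule rangeI)
  have "\<forall>f\<in>F. \<exists>x. T x = f" using FT by blast
  then obtain g where g: "\<And>f. f \<in> F \<Longrightarrow> T (g f) = f" by metis
  \<comment> \<open>Otherwise the vectors \<open>A f\<close> would span the range of
    \<open>A\<close>, while the preimages \<open>g f\<close> together with \<open>y\<close> give one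
    more independent vector there than \<open>F\<close> has elements.\<close>
  have "\<exists>x. A (x - (\<Sum>f\<in>F. (A x \<bullet> f) *\<^sub>R f)) \<noteq> 0"
  proof (rule ccontr)
    assume "\<not> ?thesis"
    then have all0: "A x = (\<Sum>f\<in>F. (A x \<bullet> f) *\<^sub>R A f)" for x
      by (simp add: blinfun.diff_right blinfun.sum_right blinfun.scaleR_right)
    have "A x \<in> span (A ` F)" for x
      by (subst all0) (intro span_sum span_scale span_base imageI)
    \<comment> \<open>Applying \<open>T\<close> removes the \<open>y\<close> term and turns each
      \<open>g f\<close> into \<open>f\<close>; orthonormality then reads off the
      coefficients.\<close>
    have coeff: "c h = 0" if "A ((\<Sum>f\<in>F. c f *\<^sub>R g f) + d *\<^sub>R y) = 0" "h \<in> F" for c d h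
    proof -
      have "A (T ((\<Sum>f\<in>F. c f *\<^sub>R g f) + d *\<^sub>R y)) = 0"
        by (rule A_bounded_apply_eq_0[OF T that(1)])
      then have "(\<Sum>f\<in>F. c f *\<^sub>R A f) = 0"
        using y(2) g by (simp add: blinfun.bilinear_simps blinfun.sum_right)
      then have "0 = (\<Sum>f\<in>F. c f *\<^sub>R A f) \<bullet> h" by simp
      also have "\<dots> = (\<Sum>f\<in>F. if f = h then c f else 0)"
        unfolding inner_sum_left using on that(2) by (intro sum.cong) auto
      also have "\<dots> = c h" using that(2) fin by simp
      finally show ?thesis by simp
    qed
    have inj: "inj_on (\<lambda>f. A (g f)) F"
    proof (rule inj_onI)
      fix f h assume fh: "f \<in> F" "h \<in> F" "A (g f) = A (g h)"
      then have "A (T (g f - g h)) = 0"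
        using A_bounded_apply_eq_0[OF T, of "g f - g h"] by (simp add: blinfun.diff_right)
      then have "A f = A h" using fh g by (simp add: blinfun.diff_right)
      then show "f = h" using on[OF fh(1,2)] on[OF fh(2,2)] by (auto split: if_splits)
    qed
    have "independent ((\<lambda>f. A (g f)) ` F)"
    proof
      assume "dependent ((\<lambda>f. A (g f)) ` F)"
      then obtain c v where v: "v \<in> (\<lambda>f. A (g f)) ` F" "c v \<noteq> 0"
        and "(\<Sum>w\<in>(\<lambda>f. A (g f)) ` F. c w *\<^sub>R w) = 0"
        using fin by (auto simp: dependent_finite)
      then have "A ((\<Sum>f\<in>F. c (A (g f)) *\<^sub>R g f) + 0 *\<^sub>R y) = 0"
        using inj by (simp add: sum.reindex blinfun.sum_right blinfun.scaleR_right)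
      from coeff[OF this] show False using v by auto
    qed
    \<comment> \<open>A relation with coefficient -1 at \<open>y\<close> has all other coefficients
      zero, which forces \<open>A y = 0\<close>.\<close>
    moreover have notin: "A y \<notin> span ((\<lambda>f. A (g f)) ` F)"
    proof
      assume "A y \<in> span ((\<lambda>f. A (g f)) ` F)"
      then obtain c where "A y = (\<Sum>w\<in>(\<lambda>f. A (g f)) ` F. c w *\<^sub>R w)"
        using fin by (auto simp: span_finite)
      then have Ay: "A y = (\<Sum>f\<in>F. c (A (g f)) *\<^sub>R A (g f))"
        using inj by (simp add: sum.reindex)
      then have "A ((\<Sum>f\<in>F. c (A (g f)) *\<^sub>R g f) + (-1) *\<^sub>R y) = 0"
        by (simp add: blinfun.bilinear_simps blinfun.sum_right)
      from coeff[OF this] have "A y = 0" unfolding Ay by (intro sum.neutral) auto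
      with y(1) show False ..
    qed
    ultimately have "independent (insert (A y) ((\<lambda>f. A (g f)) ` F))"
      by (simp add: independent_insertI)
    then have "card (insert (A y) ((\<lambda>f. A (g f)) ` F)) \<le> card (A ` F)"
      using independent_span_bound[of "A ` F"] fin \<open>\<And>x. A x \<in> span (A ` F)\<close> by blast
    moreover have "card (insert (A y) ((\<lambda>f. A (g f)) ` F)) = Suc (card F)"
    proof -
      have "A y \<notin> (\<lambda>f. A (g f)) ` F" using notin span_base by metis
      then show ?thesis using fin inj by (simp add: card_image)
    qed
    ultimately show False using card_image_le[OF fin, of A] by simp
  qed
  then obtain x where x: "A (x - (\<Sum>f\<in>F. (A x \<bullet> f) *\<^sub>R f)) \<noteq> 0" by blast
  define r where "r = x - (\<Sum>f\<in>F. (A x \<bullet> f) *\<^sub>R f)"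
  define u where "u = (1 / A_norm A r) *\<^sub>R r"
  have Fu: "A f \<bullet> u = 0" if "f \<in> F" for f
    using A_residual_orthogonal[OF fin that on, of x]
    by (simp add: A_commute[of f] u_def r_def blinfun.scaleR_right)
  have range_eq: "A (T z) = (\<Sum>f\<in>F. (A (T z) \<bullet> f) *\<^sub>R A f)" for z
    using null[of z] by (simp add: blinfun.diff_right blinfun.sum_right blinfun.scaleR_right)
  have "A (T z) \<bullet> u = 0" for z
  proof -
    have "A (T z) \<bullet> u = (\<Sum>f\<in>F. (A (T z) \<bullet> f) *\<^sub>R A f) \<bullet> u"
      using range_eq[of z] by (rule arg_cong)
    also have "\<dots> = 0" using Fu by (simp add: inner_sum_left)
    finally show ?thesis .
  qed
  then show ?thesis using that[of u] A_normalize x by (simp add: u_def r_def)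
qed

section \<open>The \<open>A\<close>-operator seminorm\<close>

context
  assumes nonzero: "A \<noteq> 0"
begin

lemma A_sphere_nonempty: "A_sphere A \<noteq> {}"
proof -
  obtain v where "A v \<noteq> 0" using nonzero by (metis blinfun_eqI zero_blinfun.rep_eq)
  from A_normalize[OF this] show ?thesis by (auto simp: A_sphere_def)
qed

lemma A_opnorm_upper:
  assumes "T \<in> A_bounded_ops A"
  shows "A_norm A (T x) \<le> A_opnorm A T * A_norm A x"
proof (cases "A x = 0")
  case True
  then have "A_norm A (T x) = 0" "A_norm A x = 0"
    using A_bounded_apply_eq_0[OF assms True] by (simp_all add: A_norm_def A_inner_def)
  then show ?thesis by simp
next
  case False
  obtain c where c: "\<And>x. A_norm A (T x) \<le> c * A_norm A x"
    using assms by (auto simp: A_bounded_ops_def)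
  have "bdd_above ((\<lambda>x. A_norm A (T x)) ` A_sphere A)"
    using c by (auto simp: A_sphere_def bdd_above_def) (metis mult.right_neutral)
  then have "A_norm A (T ((1 / A_norm A x) *\<^sub>R x)) \<le> A_opnorm A T"
    unfolding A_opnorm_def using A_normalize[OF False]
    by (intro cSUP_upper) (auto simp: A_sphere_def)
  moreover have "A_norm A x > 0"
    using False by (rule A_norm_pos)
  ultimately show ?thesis by (simp add: blinfun.scaleR_right A_norm_scaleR field_simps)
qed

lemma A_opnorm_nonneg:
  assumes "T \<in> A_bounded_ops A"
  shows "0 \<le> A_opnorm A T"
proof -
  obtain x where "A_norm A x = 1" using A_sphere_nonempty by (auto simp: A_sphere_def)
  then show ?thesis using A_opnorm_upper[OF assms, of x] A_norm_nonneg[of "T x"] by simp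
qed

lemma A_opnorm_least:
  assumes "\<And>x. A_norm A x = 1 \<Longrightarrow> A_norm A (blinfun_apply T x) \<le> c"
  shows "A_opnorm A T \<le> c"
  unfolding A_opnorm_def
  by (rule cSUP_least) (use A_sphere_nonempty assms in \<open>auto simp: A_sphere_def\<close>)

lemma A_opnorm_sq_upper:
  assumes "T \<in> A_bounded_ops A" "A x \<bullet> x = 1"
  shows "A (T x) \<bullet> T x \<le> (A_opnorm A T)\<^sup>2"
proof -
  have "A_norm A (T x) \<le> A_opnorm A T"
    using A_opnorm_upper[OF assms(1), of x] assms(2) by (simp flip: A_norm_eq_1_iff)
  then show ?thesis unfolding A_norm_sq[symmetric] by (simp add: power_mono A_norm_nonneg)
qed

lemma A_opnorm_sq_upper':
  assumes "T \<in> A_bounded_ops A"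
  shows "A (T x) \<bullet> T x \<le> (A_opnorm A T)\<^sup>2 * (A x \<bullet> x)"
proof -
  have "(A_norm A (T x))\<^sup>2 \<le> (A_opnorm A T * A_norm A x)\<^sup>2"
    by (intro power_mono A_opnorm_upper assms A_norm_nonneg)
  then show ?thesis by (simp add: power_mult_distrib A_norm_sq)
qed

lemma A_opnorm_sq_least:
  assumes T: "T \<in> A_bounded_ops A" and le: "\<And>x. A x \<bullet> x = 1 \<Longrightarrow> A (T x) \<bullet> T x \<le> c"
  shows "(A_opnorm A T)\<^sup>2 \<le> c"
proof -
  obtain x where x: "A x \<bullet> x = 1"
    using A_sphere_nonempty by (auto simp: A_sphere_def A_norm_eq_1_iff)
  have "0 \<le> c" using le[OF x] A_nonneg[of "T x"] by linarith
  have "A_opnorm A T \<le> sqrt c"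
    using le by (intro A_opnorm_least) (auto simp: A_norm_eq_1_iff A_norm_def A_inner_def)
  then have "(A_opnorm A T)\<^sup>2 \<le> (sqrt c)\<^sup>2" by (intro power_mono A_opnorm_nonneg T)
  then show ?thesis using \<open>0 \<le> c\<close> by simp
qed

lemma A_opnorm_scaleR:
  assumes T: "T \<in> A_bounded_ops A"
  shows "A_opnorm A (r *\<^sub>R T) = \<bar>r\<bar> * A_opnorm A T"
proof (cases "r = 0")
  case True
  have "(\<lambda>x. A_norm A ((r *\<^sub>R T) x)) ` A_sphere A = {0}"
    using True A_sphere_nonempty by (auto simp: A_norm_def A_inner_def)
  then show ?thesis using True by (simp add: A_opnorm_def)
next
  case False
  have le: "A_opnorm A (s *\<^sub>R S) \<le> \<bar>s\<bar> * A_opnorm A S" if "S \<in> A_bounded_ops A" for s S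
    using A_opnorm_upper[OF that]
    by (intro A_opnorm_least)
       (metis A_norm_scaleR abs_ge_zero blinfun.scaleR_left mult.right_neutral mult_left_mono)
  \<comment> \<open>The reverse inequality is the same bound for \<open>r *\<^sub>R T\<close>,
    scaled back by \<open>1 / r\<close>.\<close>
  from le[OF A_bounded_ops_scaleR[OF T, of r], of "1 / r"] False
  have "\<bar>r\<bar> * A_opnorm A T \<le> A_opnorm A (r *\<^sub>R T)" by (simp add: field_simps)
  with le[OF T, of r] show ?thesis by simp
qed

section \<open>The two directions of the equivalence\<close>

lemma A_isometry_imp_approx_right_symmetric:
  assumes iso: "A_isometry A T"
  shows "approx_right_symmetric \<epsilon> A T"
  unfolding approx_right_symmetric_def
proof (intro conjI ballI impI)
  show T: "T \<in> A_bounded_ops A" using iso by (simp add: A_isometry_def)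
  fix S assume S: "S \<in> A_bounded_ops A" and orth: "approx_orth \<epsilon> A S T"
  define t where "t = A_opnorm A T"
  define s where "s = A_opnorm A S"
  have Tx: "A (T x) \<bullet> T x = t\<^sup>2" if "A x \<bullet> x = 1" for x
  proof -
    have "x \<in> A_norm_attain A T"
      using iso that by (simp add: A_isometry_def A_sphere_def A_norm_eq_1_iff)
    then show ?thesis by (simp add: A_norm_attain_def t_def flip: A_norm_sq)
  qed
  show "approx_orth \<epsilon> A T S"
    unfolding approx_orth_def
  proof (rule allI, rule ccontr)
    fix l :: real
    \<comment> \<open>Half the amount by which the inequality fails at \<open>l\<close>; halving
      absorbs the factor 2 of the cross term.\<close>
    define \<delta> where "\<delta> = (t\<^sup>2 - 2 * \<epsilon> * t * (\<bar>l\<bar> * s) - (A_opnorm A (T + l *\<^sub>R S))\<^sup>2) / 2"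
    assume "\<not> (A_opnorm A T)\<^sup>2 - 2 * \<epsilon> * A_opnorm A T * A_opnorm A (l *\<^sub>R S)
      \<le> (A_opnorm A (T + l *\<^sub>R S))\<^sup>2"
    then have \<delta>: "\<delta> > 0" by (simp add: \<delta>_def t_def s_def A_opnorm_scaleR[OF S])
    \<comment> \<open>Expand the square and drop the nonnegative term in \<open>S x\<close>. The
      bound is uniform in \<open>x\<close> because \<open>T\<close> has constant seminorm
      \<open>t\<close> on the sphere.\<close>
    have cross: "l * (A (S x) \<bullet> T x) \<le> - (\<epsilon> * t * \<bar>l\<bar> * s) - \<delta>" if x: "A x \<bullet> x = 1" for x
    proof -
      have "A ((T + l *\<^sub>R S) x) \<bullet> (T + l *\<^sub>R S) x \<le> (A_opnorm A (T + l *\<^sub>R S))\<^sup>2"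
        by (intro A_opnorm_sq_upper A_bounded_ops_add A_bounded_ops_scaleR S T x)
      then have "t\<^sup>2 + 2 * l * (A (S x) \<bullet> T x) + l\<^sup>2 * (A (S x) \<bullet> S x) \<le> (A_opnorm A (T + l *\<^sub>R S))\<^sup>2"
        by (simp add: blinfun.add_left blinfun.scaleR_left A_square_add Tx[OF x] A_commute[of "T x" "S x"])
      moreover have "0 \<le> l\<^sup>2 * (A (S x) \<bullet> S x)" by (simp add: A_nonneg)
      moreover have "2 * \<delta> = t\<^sup>2 - 2 * \<epsilon> * t * (\<bar>l\<bar> * s) - (A_opnorm A (T + l *\<^sub>R S))\<^sup>2"
        by (simp add: \<delta>_def)
      ultimately show ?thesis by (simp add: algebra_simps)
    qed
    \<comment> \<open>Small enough that the linear gain \<open>2 * \<mu> * \<delta>\<close> exceeds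
      the quadratic term \<open>\<mu>\<^sup>2 * (l\<^sup>2 * t\<^sup>2)\<close>; the summand 1 keeps
      the denominator positive.\<close>
    define \<mu> where "\<mu> = \<delta> / (l\<^sup>2 * t\<^sup>2 + 1)"
    have den: "l\<^sup>2 * t\<^sup>2 + 1 > 0" by (simp add: add_nonneg_pos)
    have \<mu>: "\<mu> > 0" using \<delta> den by (simp add: \<mu>_def)
    have "(A_opnorm A (S + (\<mu> * l) *\<^sub>R T))\<^sup>2
        \<le> s\<^sup>2 - 2 * \<mu> * (\<epsilon> * t * \<bar>l\<bar> * s + \<delta>) + \<mu>\<^sup>2 * (l\<^sup>2 * t\<^sup>2)"
    proof (intro A_opnorm_sq_least A_bounded_ops_add A_bounded_ops_scaleR S T)
      fix x assume x: "A x \<bullet> x = 1"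
      have "A (S x) \<bullet> S x \<le> s\<^sup>2" unfolding s_def by (rule A_opnorm_sq_upper[OF S x])
      moreover have "2 * \<mu> * (l * (A (S x) \<bullet> T x)) \<le> 2 * \<mu> * (- (\<epsilon> * t * \<bar>l\<bar> * s) - \<delta>)"
        using cross[OF x] \<mu> by (intro mult_left_mono) auto
      moreover have "A ((S + (\<mu> * l) *\<^sub>R T) x) \<bullet> (S + (\<mu> * l) *\<^sub>R T) x
          = A (S x) \<bullet> S x + 2 * \<mu> * (l * (A (S x) \<bullet> T x)) + \<mu>\<^sup>2 * (l\<^sup>2 * t\<^sup>2)"
        by (simp add: blinfun.add_left blinfun.scaleR_left A_square_add Tx[OF x] power_mult_distrib)
      ultimately show "A ((S + (\<mu> * l) *\<^sub>R T) x) \<bullet> (S + (\<mu> * l) *\<^sub>R T) x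
        \<le> s\<^sup>2 - 2 * \<mu> * (\<epsilon> * t * \<bar>l\<bar> * s + \<delta>) + \<mu>\<^sup>2 * (l\<^sup>2 * t\<^sup>2)"
        by (simp add: algebra_simps)
    qed
    moreover have "s\<^sup>2 - 2 * \<epsilon> * s * (\<mu> * \<bar>l\<bar> * t) \<le> (A_opnorm A (S + (\<mu> * l) *\<^sub>R T))\<^sup>2"
      using orth \<mu> unfolding approx_orth_def
      by (auto simp: A_opnorm_scaleR[OF T] abs_mult s_def t_def dest: spec[of _ "\<mu> * l"])
    \<comment> \<open>The two terms containing \<epsilon> coincide and cancel.\<close>
    ultimately have "\<mu> * (2 * \<delta>) \<le> \<mu> * (\<mu> * (l\<^sup>2 * t\<^sup>2))"
      by (simp add: algebra_simps power2_eq_square)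
    then have "2 * \<delta> \<le> \<mu> * (l\<^sup>2 * t\<^sup>2)" using \<mu> by simp
    moreover have "\<mu> * (l\<^sup>2 * t\<^sup>2 + 1) = \<delta>"
      using den by (simp add: \<mu>_def)
    then have "\<mu> * (l\<^sup>2 * t\<^sup>2) + \<mu> = \<delta>" by (simp add: distrib_left)
    ultimately show False using \<mu> \<delta> by linarith
  qed
qed

lemma approx_right_symmetric_imp_A_isometry:
  assumes B: "finite B" "range (blinfun_apply A) \<subseteq> span B" and "0 \<le> \<epsilon>" "\<epsilon> < 1"
    and rs: "approx_right_symmetric \<epsilon> A T"
  shows "A_isometry A T"
proof (rule ccontr)
  have T: "T \<in> A_bounded_ops A" using rs by (simp add: approx_right_symmetric_def)
  define t where "t = A_opnorm A T"
  assume "\<not> A_isometry A T"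
  then obtain x0 where x0: "A_norm A x0 = 1" "A_norm A (T x0) \<noteq> t"
    using T by (auto simp: A_isometry_def A_norm_attain_def A_sphere_def t_def)
  then have x0': "A_norm A (T x0) < t" using A_opnorm_upper[OF T, of x0] by (simp add: t_def)
  obtain y where y1: "A_norm A y = 1"
    and ymin: "\<And>x. A_norm A x = 1 \<Longrightarrow> A_norm A (T y) \<le> A_norm A (T x)"
    using A_norm_attains_min[OF B nonzero T] by blast
  define m where "m = A_norm A (T y)"
  have m: "0 \<le> m" "m < t" using ymin[OF x0(1)] x0' by (auto simp: m_def A_norm_nonneg)
  have y: "A y \<bullet> y = 1" using y1 by (simp add: A_norm_eq_1_iff)
  have Ty: "A (T y) \<bullet> T y = m\<^sup>2" by (simp add: m_def A_norm_sq)
  have yorth: "A (T y) \<bullet> T w = 0" if "A y \<bullet> w = 0" for w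
    using y that ymin
    by (intro A_norm_min_orthogonal)
       (auto simp: A_norm_eq_1_iff A_norm_nonneg simp flip: A_norm_sq intro!: power_mono)
  \<comment> \<open>If \<open>m = 0\<close>, then \<open>T y\<close> is a null vector and the
    dimension count supplies \<open>u\<close>. Otherwise \<open>u\<close> is \<open>T y\<close>
    normalised, with the sign reversed to make its pairing with \<open>T y\<close>
    nonpositive.\<close>
  obtain u where u: "A u \<bullet> u = 1" "A (T y) \<bullet> u \<le> 0"
    and uorth: "\<And>w. A y \<bullet> w = 0 \<Longrightarrow> A (T w) \<bullet> u = 0"
  proof (cases "m = 0")
    case True
    then have "A (T y) \<bullet> T y = 0" using Ty by simp
    then have "A (T y) = 0" using A_eq_0_iff by blast
    moreover have "A y \<noteq> 0" using y by auto
    ultimately show ?thesis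
      using A_orthogonal_to_range_exists[OF B T] that by (metis A_norm_eq_1_iff order_refl)
  next
    case False
    show ?thesis
    proof (rule that[of "(- 1 / m) *\<^sub>R T y"])
      show "A ((- 1 / m) *\<^sub>R T y) \<bullet> ((- 1 / m) *\<^sub>R T y) = 1"
        using False by (simp add: blinfun.scaleR_right blinfun.minus_right Ty power2_eq_square)
      show "A (T y) \<bullet> (- 1 / m) *\<^sub>R T y \<le> 0"
        using m False by (simp add: Ty)
      show "A (T w) \<bullet> (- 1 / m) *\<^sub>R T y = 0" if "A y \<bullet> w = 0" for w
        using yorth[OF that] by (simp add: A_commute[of "T w" "T y"])
    qed
  qed
  \<comment> \<open>Since \<open>A y \<bullet> x\<close> is the coordinate of \<open>x\<close> along
    \<open>y\<close>, this rank-one correction keeps \<open>T\<close> on the complement of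
    \<open>y\<close> and sends \<open>y\<close> to \<open>t *\<^sub>R u\<close>.\<close>
  define S where "S = T + Blinfun (\<lambda>x. (A y \<bullet> x) *\<^sub>R (t *\<^sub>R u - T y))"
  have "bounded_linear (\<lambda>x. (A y \<bullet> x) *\<^sub>R (t *\<^sub>R u - T y))"
    by (intro bounded_linear_scaleR_const bounded_linear_inner_right)
  then have S_apply: "S x = T x + (A y \<bullet> x) *\<^sub>R (t *\<^sub>R u - T y)" for x
    by (simp add: S_def blinfun.add_left bounded_linear_Blinfun_apply)
  \<comment> \<open>Pythagoras for the image of \<open>x\<close>: \<open>T\<close> maps the
    complement of \<open>y\<close> into vectors orthogonal to both \<open>T y\<close> and
    \<open>u\<close>. Suitable \<open>p\<close> and \<open>q\<close> give \<open>T\<close>,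
    \<open>S\<close>, \<open>S + l *\<^sub>R T\<close> and \<open>T - l *\<^sub>R S\<close>.\<close>
  have split: "A (p *\<^sub>R T x + q *\<^sub>R S x) \<bullet> (p *\<^sub>R T x + q *\<^sub>R S x)
      = (p + q)\<^sup>2 * (A (T (x - (A y \<bullet> x) *\<^sub>R y)) \<bullet> T (x - (A y \<bullet> x) *\<^sub>R y))
        + (A y \<bullet> x)\<^sup>2 * (p\<^sup>2 * m\<^sup>2 + 2 * p * q * t * (A (T y) \<bullet> u) + q\<^sup>2 * t\<^sup>2)" for p q x
  proof -
    define w where "w = x - (A y \<bullet> x) *\<^sub>R y"
    define v where "v = p *\<^sub>R T y + (q * t) *\<^sub>R u"
    have w: "A y \<bullet> w = 0" by (simp add: w_def inner_diff_right y)
    have "p *\<^sub>R T x + q *\<^sub>R S x = (p + q) *\<^sub>R T w + (A y \<bullet> x) *\<^sub>R v"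
      by (simp add: S_apply w_def v_def blinfun.diff_right blinfun.scaleR_right algebra_simps)
    moreover have "A ((p + q) *\<^sub>R T w) \<bullet> v = 0"
      using yorth[OF w] uorth[OF w] A_commute[of "T w" "T y"]
      by (simp add: v_def inner_add_right blinfun.scaleR_right)
    moreover have "A v \<bullet> v = p\<^sup>2 * m\<^sup>2 + 2 * p * q * t * (A (T y) \<bullet> u) + q\<^sup>2 * t\<^sup>2"
      unfolding v_def A_square_add
      by (simp add: blinfun.scaleR_right Ty u power2_eq_square algebra_simps)
    ultimately show ?thesis
      by (simp only: A_square_add w_def) (simp add: blinfun.scaleR_right power2_eq_square)
  qed
  have pyth: "A x \<bullet> x = A (x - (A y \<bullet> x) *\<^sub>R y) \<bullet> (x - (A y \<bullet> x) *\<^sub>R y) + (A y \<bullet> x)\<^sup>2" for x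
    using A_square_add[of x "- (A y \<bullet> x)" y] y A_commute[of x y] by (simp add: power2_eq_square)
  have Tle: "A (T x) \<bullet> T x \<le> t\<^sup>2 * (A x \<bullet> x)" for x
    unfolding t_def by (rule A_opnorm_sq_upper'[OF T])
  have "A_norm A (S x) \<le> t * A_norm A x" for x
  proof (rule power2_le_imp_le)
    let ?w = "x - (A y \<bullet> x) *\<^sub>R y"
    have "A (S x) \<bullet> S x = A (T ?w) \<bullet> T ?w + t\<^sup>2 * (A y \<bullet> x)\<^sup>2"
      using split[of 0 x 1] by simp
    also have "\<dots> \<le> t\<^sup>2 * (A ?w \<bullet> ?w + (A y \<bullet> x)\<^sup>2)"
      using Tle[of ?w] by (simp add: distrib_left)
    also have "\<dots> = t\<^sup>2 * (A x \<bullet> x)" using pyth[of x] by simp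
    finally show "(A_norm A (S x))\<^sup>2 \<le> (t * A_norm A x)\<^sup>2"
      by (simp add: A_norm_sq power_mult_distrib)
  qed (use m A_norm_nonneg in auto)
  then have S: "S \<in> A_bounded_ops A" and St: "A_opnorm A S \<le> t"
    using A_bounded_opsI[of S t] A_opnorm_least[of S t] by (auto, metis mult.right_neutral)
  have "approx_orth \<epsilon> A S T"
    unfolding approx_orth_def
  proof
    fix l :: real
    define K where "K = A_opnorm A (S + l *\<^sub>R T)"
    have K: "S + l *\<^sub>R T \<in> A_bounded_ops A" "0 \<le> K"
      unfolding K_def by (intro A_opnorm_nonneg A_bounded_ops_add A_bounded_ops_scaleR S T)+
    have SlT: "A ((S + l *\<^sub>R T) x) \<bullet> (S + l *\<^sub>R T) x \<le> K\<^sup>2 * (A x \<bullet> x)" for x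
      unfolding K_def by (rule A_opnorm_sq_upper'[OF K(1)])
    have eq: "(S + l *\<^sub>R T) x = l *\<^sub>R T x + 1 *\<^sub>R S x" for x
      by (simp add: blinfun.add_left blinfun.scaleR_left)
    \<comment> \<open>For \<open>l \<le> 0\<close> test at \<open>y\<close>, where
      \<open>S y\<close> contributes \<open>t\<^sup>2\<close> and the cross term is nonnegative. For
      \<open>l > 0\<close> test on the complement of \<open>y\<close>, where the operator is
      \<open>(1 + l) *\<^sub>R T\<close>.\<close>
    have "t\<^sup>2 \<le> K\<^sup>2"
    proof (cases "l \<le> 0")
      case True
      have "0 \<le> l * (A (T y) \<bullet> u)" using True u(2) by (rule mult_nonpos_nonpos)
      then have "0 \<le> t * (l * (A (T y) \<bullet> u))" using m by simp
      moreover have "l\<^sup>2 * m\<^sup>2 + 2 * (t * (l * (A (T y) \<bullet> u))) + t\<^sup>2 \<le> K\<^sup>2"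
        using SlT[of y] unfolding eq split by (simp add: y algebra_simps)
      moreover have "0 \<le> l\<^sup>2 * m\<^sup>2" by simp
      ultimately show ?thesis by linarith
    next
      case False
      have Tw: "A (T w) \<bullet> T w \<le> K\<^sup>2 * (A w \<bullet> w)" if w: "A y \<bullet> w = 0" for w
      proof -
        have "1 * (A (T w) \<bullet> T w) \<le> (l + 1)\<^sup>2 * (A (T w) \<bullet> T w)"
          using False by (intro mult_right_mono A_nonneg) auto
        also have "\<dots> \<le> K\<^sup>2 * (A w \<bullet> w)" using SlT[of w] unfolding eq split by (simp add: w)
        finally show ?thesis by simp
      qed
      \<comment> \<open>\<open>T\<close> contributes only \<open>m\<close> along \<open>y\<close>;
        as \<open>m < t\<close>, the maximum has to be \<open>K\<^sup>2\<close>.\<close>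
      have "(A_opnorm A T)\<^sup>2 \<le> max (K\<^sup>2) (m\<^sup>2)"
      proof (rule A_opnorm_sq_least[OF T])
        fix x assume x: "A x \<bullet> x = 1"
        let ?w = "x - (A y \<bullet> x) *\<^sub>R y"
        have w: "A y \<bullet> ?w = 0" by (simp add: inner_diff_right y)
        have "A (T x) \<bullet> T x = A (T ?w) \<bullet> T ?w + (A y \<bullet> x)\<^sup>2 * m\<^sup>2"
          using split[of 1 x 0] by simp
        also have "\<dots> \<le> K\<^sup>2 * (A ?w \<bullet> ?w) + m\<^sup>2 * (A y \<bullet> x)\<^sup>2" using Tw[OF w] by simp
        also have "\<dots> \<le> max (K\<^sup>2) (m\<^sup>2) * (A ?w \<bullet> ?w) + max (K\<^sup>2) (m\<^sup>2) * (A y \<bullet> x)\<^sup>2"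
          by (intro add_mono mult_right_mono A_nonneg) auto
        also have "\<dots> = max (K\<^sup>2) (m\<^sup>2)" using pyth[of x] x by (simp flip: distrib_left)
        finally show "A (T x) \<bullet> T x \<le> max (K\<^sup>2) (m\<^sup>2)" .
      qed
      moreover have "m\<^sup>2 < t\<^sup>2" using m by (intro power_strict_mono) auto
      ultimately show ?thesis by (simp add: t_def max_def split: if_splits)
    qed
    moreover have "(A_opnorm A S)\<^sup>2 \<le> t\<^sup>2" using St A_opnorm_nonneg[OF S] by (intro power_mono)
    moreover have "0 \<le> 2 * \<epsilon> * A_opnorm A S * A_opnorm A (l *\<^sub>R T)"
      using assms(3) A_opnorm_nonneg[OF S] A_opnorm_nonneg[OF A_bounded_ops_scaleR[OF T]] by simp
    ultimately show "(A_opnorm A S)\<^sup>2 - 2 * \<epsilon> * A_opnorm A S * A_opnorm A (l *\<^sub>R T)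
      \<le> (A_opnorm A (S + l *\<^sub>R T))\<^sup>2"
      unfolding K_def by linarith
  qed
  then have "approx_orth \<epsilon> A T S" using rs S by (simp add: approx_right_symmetric_def)
  \<comment> \<open>The second bound is equivalent to \<open>m + l * t \<le> (1 - l) * t\<close>;
    the first contradicts the final inequality.\<close>
  define l where "l = min (1 - \<epsilon>) ((t - m) / (2 * t))"
  have t: "t > 0" using m by linarith
  have l: "0 < l" "l \<le> 1 - \<epsilon>" "l \<le> (t - m) / (2 * t)" using assms(4) m t by (auto simp: l_def)
  have lm: "m + l * t \<le> (1 - l) * t" using l(3) t by (simp add: field_simps)
  have l1: "l < 1"
  proof -
    have "(t - m) / (2 * t) < 1" using m t by simp
    with l(3) show ?thesis by linarith
  qed
  \<comment> \<open>On the complement of \<open>y\<close> the operator is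
    \<open>(1 - l) *\<^sub>R T\<close>; at \<open>y\<close> its seminorm is at most
    \<open>m + l * t\<close> by Cauchy-Schwarz.\<close>
  have "(A_opnorm A (T + (- l) *\<^sub>R S))\<^sup>2 \<le> ((1 - l) * t)\<^sup>2"
  proof (intro A_opnorm_sq_least A_bounded_ops_add A_bounded_ops_scaleR S T)
    fix x assume x: "A x \<bullet> x = 1"
    let ?w = "x - (A y \<bullet> x) *\<^sub>R y"
    have "(A (T y) \<bullet> u)\<^sup>2 \<le> m\<^sup>2" using A_Cauchy_Schwarz[of "T y" u] u by (simp add: Ty)
    then have "- (A (T y) \<bullet> u) \<le> m" using m(1) abs_le_square_iff[of "A (T y) \<bullet> u" m] by simp
    then have "l * t * - (A (T y) \<bullet> u) \<le> l * t * m" using l t by (intro mult_left_mono) auto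
    then have "m\<^sup>2 - 2 * l * t * (A (T y) \<bullet> u) + l\<^sup>2 * t\<^sup>2 \<le> (m + l * t)\<^sup>2"
      by (simp add: power2_eq_square algebra_simps)
    also have "\<dots> \<le> ((1 - l) * t)\<^sup>2" using lm m l t by (intro power_mono) auto
    finally have "(A y \<bullet> x)\<^sup>2 * (m\<^sup>2 - 2 * l * t * (A (T y) \<bullet> u) + l\<^sup>2 * t\<^sup>2)
        \<le> (A y \<bullet> x)\<^sup>2 * ((1 - l) * t)\<^sup>2"
      by (intro mult_left_mono) auto
    moreover have "(1 - l)\<^sup>2 * (A (T ?w) \<bullet> T ?w) \<le> (1 - l)\<^sup>2 * (t\<^sup>2 * (A ?w \<bullet> ?w))"
      by (intro mult_left_mono Tle) auto
    moreover have "A ((T + (- l) *\<^sub>R S) x) \<bullet> (T + (- l) *\<^sub>R S) x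
        = (1 - l)\<^sup>2 * (A (T ?w) \<bullet> T ?w)
          + (A y \<bullet> x)\<^sup>2 * (m\<^sup>2 - 2 * l * t * (A (T y) \<bullet> u) + l\<^sup>2 * t\<^sup>2)"
      using split[of 1 x "- l"] by (simp add: blinfun.diff_left blinfun.scaleR_left)
    moreover have "(1 - l)\<^sup>2 * (t\<^sup>2 * (A ?w \<bullet> ?w)) + (A y \<bullet> x)\<^sup>2 * ((1 - l) * t)\<^sup>2 = ((1 - l) * t)\<^sup>2"
    proof -
      have "(1 - l)\<^sup>2 * (t\<^sup>2 * (A ?w \<bullet> ?w)) + (A y \<bullet> x)\<^sup>2 * ((1 - l) * t)\<^sup>2
        = ((1 - l) * t)\<^sup>2 * (A ?w \<bullet> ?w + (A y \<bullet> x)\<^sup>2)"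
        by (simp add: power_mult_distrib distrib_left mult_ac)
      then show ?thesis using pyth[of x] x by simp
    qed
    ultimately show "A ((T + (- l) *\<^sub>R S) x) \<bullet> (T + (- l) *\<^sub>R S) x \<le> ((1 - l) * t)\<^sup>2"
      by linarith
  qed
  moreover have "t\<^sup>2 - 2 * \<epsilon> * t * (l * t) \<le> (A_opnorm A (T + (- l) *\<^sub>R S))\<^sup>2"
  proof -
    \<comment> \<open>Replacing \<open>A_opnorm A S\<close> by its upper bound \<open>t\<close> only
      weakens the inequality.\<close>
    have "2 * \<epsilon> * t * (l * A_opnorm A S) \<le> 2 * \<epsilon> * t * (l * t)"
      using St assms(3) t l by (intro mult_left_mono) auto
    moreover have "t\<^sup>2 - 2 * \<epsilon> * t * (l * A_opnorm A S) \<le> (A_opnorm A (T + (- l) *\<^sub>R S))\<^sup>2"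
      using \<open>approx_orth \<epsilon> A T S\<close> l(1) unfolding approx_orth_def
      by (auto simp: A_opnorm_scaleR[OF S] t_def simp del: scaleR_minus_left dest!: spec[of _ "- l"])
    ultimately show ?thesis by linarith
  qed
  ultimately have "t\<^sup>2 * (1 - 2 * \<epsilon> * l) \<le> t\<^sup>2 * (1 - l)\<^sup>2"
    by (simp add: power_mult_distrib power2_eq_square algebra_simps)
  then have "1 - 2 * \<epsilon> * l \<le> (1 - l)\<^sup>2" using t by simp
  \<comment> \<open>Cancelling \<open>l\<close> leaves \<open>2 * (1 - \<epsilon>) \<le> l\<close>,
    which is impossible for \<open>l \<le> 1 - \<epsilon>\<close> and \<epsilon> < 1.\<close>
  then have "l * (2 * (1 - \<epsilon>)) \<le> l * l" by (simp add: power2_eq_square algebra_simps)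
  then show False using l assms(4) by simp
qed

end

end

theorem theorem3p4:
  fixes A T :: "'a::{real_inner, complete_space} \<Rightarrow>\<^sub>L 'a" and \<epsilon> :: real
  assumes "positive_op A" and "A \<noteq> 0"
    and "finite_dim (closure (range (blinfun_apply A)))"
    and "0 \<le> \<epsilon>" and "\<epsilon> < 1"
    and "T \<in> A_bounded_ops A"
  shows "approx_right_symmetric \<epsilon> A T \<longleftrightarrow> A_isometry A T"
proof -
  \<comment> \<open>A finite spanning set of the closure also covers the range; finite dimension
    enters the lemmas in this form.\<close>
  obtain B where "finite B" "range (blinfun_apply A) \<subseteq> span B"
    using assms(3) closure_subset unfolding finite_dim_def by metis
  then show ?thesis
    using approx_right_symmetric_imp_A_isometry A_isometry_imp_approx_right_symmetric assms
    by blast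
qed

end
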